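(* Let $\mathcal{B}$ be a generalized backward shift on an infinite-dimensional complex Banach space $X$, let $\lambda\in\mathbb{C}\setminus\{0\}$, and let $A$ be an extended $\lambda$-eigenoperator of $\mathcal{B}$. If $\ker(A)\supset\ker(\mathcal{B})$, then $A$ is supercyclic.
   Context: A bounded linear operator $\mathcal{B}$ on a Banach space $X$ is a generalized backward shift if (i) $\ker\mathcal{B}$ is one-dimensional and (ii) $\bigcup\{\ker\mathcal{B}^n:n=0,1,2,\dots\}$ is dense in $X$. An extended $\lambda$-eigenoperator of $\mathcal{B}$ is a bounded linear operator $A\neq0$ on $X$ with $\mathcal{B}A=\lambda A\mathcal{B}$. A bounded operator $A$ on $X$ is supercyclic if there is $x\in X$ such that $\{\mu A^nx:\mu\in\mathbb{C},\,n\in\mathbb{N}\}$ is dense in $X$. $\ker(A)\supset\ker(\mathcal{B})$ is (non-strict) inclusion. *)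

theory Defs
  imports "HOL-Analysis.Analysis"
begin

text \<open>
  The distribution has only real normed spaces. A complex Banach space is a real Banach space with
  a complex scalar multiplication that extends the real one and for which the norm is homogeneous.
\<close>

class complex_vector = real_vector +
  fixes scaleC :: "complex \<Rightarrow> 'a \<Rightarrow> 'a"  (infixr "*\<^sub>C" 75)
  assumes scaleC_add_right: "a *\<^sub>C (x + y) = a *\<^sub>C x + a *\<^sub>C y"
    and scaleC_add_left: "(a + b) *\<^sub>C x = a *\<^sub>C x + b *\<^sub>C x"
    and scaleC_scaleC: "a *\<^sub>C (b *\<^sub>C x) = (a * b) *\<^sub>C x"
    and scaleC_one: "1 *\<^sub>C x = x"
    and scaleR_scaleC: "r *\<^sub>R x = complex_of_real r *\<^sub>C x"

class complex_normed_vector = complex_vector + real_normed_vector +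
  assumes norm_scaleC: "norm (a *\<^sub>C x) = cmod a * norm x"

class complex_banach = complex_normed_vector + banach

global_interpretation complex_vector:
  vector_space "scaleC :: complex \<Rightarrow> 'a \<Rightarrow> 'a::complex_vector"
  by unfold_locales
    (rule scaleC_add_right scaleC_add_left scaleC_scaleC scaleC_one)+

instantiation complex :: complex_banach
begin

definition scaleC_complex :: "complex \<Rightarrow> complex \<Rightarrow> complex"
  where "scaleC_complex a x = a * x"

instance
  by standard
    (simp_all add: scaleC_complex_def algebra_simps scaleR_conv_of_real norm_mult)

end

definition infinite_dimensional :: "'a::complex_vector itself \<Rightarrow> bool"
  where "infinite_dimensional _ \<longleftrightarrow>
    (\<nexists>S :: 'a set. finite S \<and> complex_vector.span S = UNIV)"

definition bounded_clinear ::
    "('a::complex_normed_vector \<Rightarrow> 'b::complex_normed_vector) \<Rightarrow> bool"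
  where "bounded_clinear f \<longleftrightarrow>
    Vector_Spaces.linear scaleC scaleC f \<and> (\<exists>K. \<forall>x. norm (f x) \<le> K * norm x)"

definition ker :: "('a \<Rightarrow> 'b::zero) \<Rightarrow> 'a set"
  where "ker f = {x. f x = 0}"

text \<open>
  The library's \<^term>\<open>complex_vector.dim\<close> is 0 on infinite-dimensional subspaces, so the value 1
  does mean one-dimensional.
\<close>

definition generalized_backward_shift ::
    "('a::complex_banach \<Rightarrow> 'a) \<Rightarrow> bool"
  where "generalized_backward_shift B \<longleftrightarrow>
    bounded_clinear B \<and>
    complex_vector.dim (ker B) = 1 \<and>
    closure (\<Union>n. ker (B ^^ n)) = UNIV"

definition extended_eigenoperator ::
    "complex \<Rightarrow> ('a::complex_banach \<Rightarrow> 'a) \<Rightarrow> ('a \<Rightarrow> 'a) \<Rightarrow> bool"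
  where "extended_eigenoperator l B A \<longleftrightarrow>
    bounded_clinear A \<and> A \<noteq> (\<lambda>x. 0) \<and> (\<forall>x. B (A x) = l *\<^sub>C A (B x))"

text \<open>
  The exponent \<open>n\<close> ranges over all naturals including 0. On an infinite-dimensional space starting
  at 1 gives the same notion, because the line through \<open>x\<close> is closed and nowhere dense.
\<close>

definition supercyclic :: "('a::complex_banach \<Rightarrow> 'a) \<Rightarrow> bool"
  where "supercyclic A \<longleftrightarrow>
    bounded_clinear A \<and> (\<exists>x. closure {c *\<^sub>C (A ^^ n) x | c n. True} = UNIV)"

end

theory Submission
  imports Defs
begin

text \<open>
  Let \<open>V\<close> be the union of the kernels \<open>ker (B ^^ n)\<close>. Each step of this chain of kernels adds at
  most one dimension, so \<open>V\<close> is separable, and since \<open>V\<close> is dense in an infinite-dimensional space,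
  \<open>B\<close> maps \<open>V\<close> onto itself. As \<open>A\<close> annihilates \<open>ker B\<close>, it maps \<open>ker (B ^^ Suc n)\<close> into
  \<open>ker (B ^^ n)\<close>, so \<open>A\<close> is locally nilpotent on \<open>V\<close>. At the first level of the chain on which \<open>A\<close>
  does not vanish its values lie in \<open>ker B\<close>, so \<open>ker B \<subseteq> A ` V\<close>; lifting along \<open>B\<close> gives
  \<open>V \<subseteq> A ` V\<close>. A Baire category argument then yields a supercyclic vector: if \<open>w, s \<in> V\<close> and
  \<open>(A ^^ m) w = 0\<close>, then \<open>w + \<epsilon> s\<close> is close to \<open>w\<close> and is mapped by \<open>\<epsilon>\<^sup>-\<^sup>1 (A ^^ m)\<close> to \<open>(A ^^ m) s\<close>.
\<close>

section \<open>Bounded complex-linear operators\<close>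

text \<open>Supplies the joint continuity of complex scaling, used for the open sets of the Baire
  argument and for separability.\<close>

lemma bounded_bilinear_scaleC:
  "bounded_bilinear (scaleC :: complex \<Rightarrow> 'a \<Rightarrow> 'a::complex_normed_vector)"
proof
  show "\<exists>K. \<forall>a (x::'a). norm (a *\<^sub>C x) \<le> norm a * norm x * K"
    by (rule exI[of _ 1]) (simp add: norm_scaleC)
qed (simp_all add: scaleC_add_left scaleC_add_right scaleR_scaleC[where 'a='a] scaleC_scaleC
      scaleR_conv_of_real mult.commute)

lemmas continuous_on_scaleC [continuous_intros] =
  bounded_bilinear.continuous_on[OF bounded_bilinear_scaleC]

lemma
  assumes "bounded_clinear f"
  shows bounded_clinear_add: "f (x + y) = f x + f y"
    and bounded_clinear_scaleC: "f (c *\<^sub>C x) = c *\<^sub>C f x"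
    and bounded_clinear_bounded_linear: "bounded_linear f"
proof -
  show add: "f (x + y) = f x + f y" and scale: "f (c *\<^sub>C x) = c *\<^sub>C f x" for x y c
    using assms by (simp_all add: bounded_clinear_def Vector_Spaces.linear_iff)
  obtain K where "\<And>x. norm (f x) \<le> K * norm x"
    using assms unfolding bounded_clinear_def by blast
  then show "bounded_linear f"
    by (intro bounded_linear_intro[of f K]) (simp_all add: add scale scaleR_scaleC mult.commute)
qed

lemma bounded_clinear_funpow:
  fixes f :: "'a::complex_normed_vector \<Rightarrow> 'a"
  assumes f: "bounded_clinear f"
  shows "bounded_clinear (f ^^ n)"
proof -
  have add: "(f ^^ n) (x + y) = (f ^^ n) x + (f ^^ n) y"
    and scale: "(f ^^ n) (c *\<^sub>C x) = c *\<^sub>C (f ^^ n) x"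
    and bounded: "bounded_linear (f ^^ n)" for x y c
    by (induction n)
      (simp_all add: bounded_clinear_add[OF f] bounded_clinear_scaleC[OF f] id_def comp_def
        bounded_linear_ident bounded_linear_compose[OF bounded_clinear_bounded_linear[OF f]])
  obtain K where "\<And>x. norm ((f ^^ n) x) \<le> norm x * K"
    using bounded_linear.bounded[OF bounded] by blast
  then show ?thesis
    unfolding bounded_clinear_def Vector_Spaces.linear_iff
    using complex_vector.vector_space_axioms by (auto simp: add scale mult.commute)
qed

lemma bounded_clinear_simps:
  assumes "bounded_clinear f"
  shows "f (x + y) = f x + f y" "f (x - y) = f x - f y" "f 0 = 0" "f (c *\<^sub>C x) = c *\<^sub>C f x"
  using bounded_clinear_bounded_linear[OF assms] bounded_clinear_scaleC[OF assms]
  by (simp_all add: linear_simps)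

lemma closed_ker:
  assumes "bounded_clinear f"
  shows "closed (ker f)"
  unfolding ker_def
  by (intro closed_Collect_eq continuous_on_const linear_continuous_on
      bounded_clinear_bounded_linear[OF assms])

section \<open>A supercyclicity criterion\<close>

lemma supercyclicI_locally_nilpotent:
  fixes A :: "'a::complex_banach \<Rightarrow> 'a" and D V :: "'a set"
  assumes A: "bounded_clinear A"
    and D: "countable D" "closure D = UNIV"
    and V: "closure V = UNIV"
    and surj: "V \<subseteq> A ` V"
    and nil: "\<And>v. v \<in> V \<Longrightarrow> \<exists>n. (A ^^ n) v = 0"
  shows "supercyclic A"
proof -
  note [simp] = bounded_clinear_simps[OF bounded_clinear_funpow[OF A]]
  have surj_pow: "V \<subseteq> (A ^^ n) ` V" for n
  proof (induction n)
    case (Suc n)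
    have "V \<subseteq> A ` V" by (rule surj)
    also have "\<dots> \<subseteq> A ` (A ^^ n) ` V" using Suc by (rule image_mono)
    finally show ?case by (simp add: image_comp comp_def)
  qed simp
  \<comment> \<open>\<open>G U\<close> collects the vectors some scalar multiple of whose orbit
    under \<open>A\<close> meets \<open>U\<close>.\<close>
  define G where "G U = (\<Union>c n. (\<lambda>x. c *\<^sub>C (A ^^ n) x) -` U)" for U
  have G_open: "open (G U)" if "open U" for U
    unfolding G_def
    by (intro open_UN ballI open_vimage that continuous_on_scaleC continuous_on_const
        linear_continuous_on bounded_clinear_bounded_linear[OF bounded_clinear_funpow[OF A]])
  have G_dense: "closure (G U) = UNIV" if U: "open U" "U \<noteq> {}" for U
  proof -
    have "G U \<inter> W \<noteq> {}" if W: "open W" "W \<noteq> {}" for W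
    proof -
      have "W \<inter> V \<noteq> {}" "U \<inter> V \<noteq> {}"
        using W U V open_Int_closure_eq_empty[of _ V] by auto
      then obtain w u where w: "w \<in> W" "w \<in> V" and u: "u \<in> U" "u \<in> V"
        by blast
      obtain m where m: "(A ^^ m) w = 0"
        using nil w by blast
      obtain s where s: "(A ^^ m) s = u"
        using surj_pow[of m] u by blast
      have "((\<lambda>e. w + e *\<^sub>R s) \<longlongrightarrow> w + 0 *\<^sub>R s) (at_right (0::real))"
        by (intro tendsto_intros)
      then have "eventually (\<lambda>e. w + e *\<^sub>R s \<in> W) (at_right (0::real))"
        using W w by (auto simp: tendsto_def)
      then have "eventually (\<lambda>e. w + e *\<^sub>R s \<in> W \<and> e > 0) (at_right (0::real))"
        by (rule eventually_conj) (rule eventually_at_right_less)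
      then have "\<exists>e::real. w + e *\<^sub>R s \<in> W \<and> e > 0"
        by (rule eventually_happens'[rotated]) simp
      then obtain e :: real where e: "e > 0" "w + e *\<^sub>R s \<in> W"
        by blast
      \<comment> \<open>\<open>A ^^ m\<close> kills \<open>w\<close> and sends
        \<open>e *\<^sub>R s\<close> to \<open>e *\<^sub>R u\<close>, so the factor
        \<open>1/e\<close> restores \<open>u\<close> however small \<open>e\<close> is.\<close>
      have "complex_of_real (1/e) *\<^sub>C (A ^^ m) (w + e *\<^sub>R s) = u"
        using e m s by (simp add: scaleR_scaleC scaleC_scaleC scaleC_one)
      then have "w + e *\<^sub>R s \<in> G U"
        unfolding G_def using u by fast
      then show ?thesis
        using e by blast
    qed
    \<comment> \<open>The complement of the closure is open and misses \<open>G U\<close>, so it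
      must be empty.\<close>
    from this[of "- closure (G U)"] show ?thesis
      using closure_subset[of "G U"] by auto
  qed
  \<comment> \<open>These countably many balls form a base, so a vector in every member of the
    family is supercyclic.\<close>
  define \<G> where "\<G> = (\<lambda>(d, n). G (ball d (inverse (real (Suc n))))) ` (D \<times> UNIV)"
  have "(euclidean :: 'a topology) closure_of \<Inter>\<G> = topspace euclidean"
  proof (rule Baire_category)
    show "countable \<G>"
      unfolding \<G>_def using D by auto
    show "openin euclidean T \<and> euclidean closure_of T = topspace euclidean" if "T \<in> \<G>" for T
      using that unfolding \<G>_def by (auto simp: G_open G_dense)
  qed (simp add: completely_metrizable_space_euclidean)
  then have "\<Inter>\<G> \<noteq> {}"
    by force
  then obtain x where x: "x \<in> \<Inter>\<G>"
    by blast
  have "y \<in> closure {c *\<^sub>C (A ^^ n) x | c n. True}" for y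
    unfolding closure_approachable
  proof (intro allI impI)
    fix e :: real assume "e > 0"
    then obtain k where k: "inverse (real (Suc k)) < e / 2"
      using reals_Archimedean[of "e / 2"] by auto
    obtain d where d: "d \<in> D" "dist d y < e / 2"
      using D(2) \<open>e > 0\<close> closure_approachable[of y D] by (metis UNIV_I half_gt_zero)
    have "x \<in> G (ball d (inverse (real (Suc k))))"
      using x d unfolding \<G>_def by blast
    then obtain c n where "dist d (c *\<^sub>C (A ^^ n) x) < inverse (real (Suc k))"
      unfolding G_def by auto
    with k d(2) have "dist (c *\<^sub>C (A ^^ n) x) y < e"
      using dist_triangle[of "c *\<^sub>C (A ^^ n) x" y d] dist_commute[of d "c *\<^sub>C (A ^^ n) x"]
      by linarith
    then show "\<exists>z\<in>{c *\<^sub>C (A ^^ n) x | c n. True}. dist z y < e"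
      by blast
  qed
  then show ?thesis
    unfolding supercyclic_def using A by blast
qed

section \<open>The kernels of the powers of a generalized backward shift\<close>

lemma generalized_backward_shift_ker:
  assumes "generalized_backward_shift B"
  obtains e where "ker B = range (\<lambda>c. c *\<^sub>C e)"
proof -
  have B: "bounded_clinear B" and dim: "complex_vector.dim (ker B) = 1"
    using assms by (auto simp: generalized_backward_shift_def)
  obtain S where S: "S \<subseteq> ker B" "complex_vector.independent S" "ker B \<subseteq> complex_vector.span S"
      "card S = 1"
    using complex_vector.basis_exists[of "ker B"] dim by metis
  then obtain e where e: "S = {e}"
    by (auto simp: card_1_singleton_iff)
  have "ker B = range (\<lambda>c. c *\<^sub>C e)"
  proof
    show "ker B \<subseteq> range (\<lambda>c. c *\<^sub>C e)"
      using S(3) by (simp add: e complex_vector.span_singleton)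
    show "range (\<lambda>c. c *\<^sub>C e) \<subseteq> ker B"
      using S(1) by (auto simp: e ker_def bounded_clinear_simps[OF B])
  qed
  then show thesis by (rule that)
qed

text \<open>\<open>B ^^ n\<close> maps \<open>ker (B ^^ Suc n)\<close> into the line
  \<open>ker B\<close>, and what it annihilates is \<open>ker (B ^^ n)\<close>. The quotient thus
  has dimension at most one and is spanned by the class of any \<open>u\<close> outside
  \<open>ker (B ^^ n)\<close>.\<close>

lemma ker_funpow_Suc_decompose:
  assumes B: "generalized_backward_shift B"
    and u: "u \<in> ker (B ^^ Suc n)" "u \<notin> ker (B ^^ n)"
    and y: "y \<in> ker (B ^^ Suc n)"
  obtains c z where "z \<in> ker (B ^^ n)" "y = c *\<^sub>C u + z"
proof -
  have "bounded_clinear B"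
    using B by (simp add: generalized_backward_shift_def)
  note [simp] = bounded_clinear_simps[OF bounded_clinear_funpow[OF this]]
  obtain e where e: "ker B = range (\<lambda>c. c *\<^sub>C e)"
    using generalized_backward_shift_ker[OF B] by blast
  have "(B ^^ n) u \<in> ker B" "(B ^^ n) y \<in> ker B"
    using u y by (simp_all add: ker_def)
  then obtain a b where ab: "(B ^^ n) u = a *\<^sub>C e" "(B ^^ n) y = b *\<^sub>C e"
    unfolding e by blast
  have "a \<noteq> 0"
    using u(2) ab by (auto simp: ker_def)
  then have "y - (b / a) *\<^sub>C u \<in> ker (B ^^ n)"
    by (simp add: ker_def ab scaleC_scaleC)
  then show thesis
    by (rule that[where c = "b / a"]) simp
qed

lemma ker_funpow_Suc_subset:
  assumes B: "generalized_backward_shift B"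
  obtains u where "\<And>y. y \<in> ker (B ^^ Suc n) \<Longrightarrow> \<exists>c. \<exists>z\<in>ker (B ^^ n). y = c *\<^sub>C u + z"
proof (cases "ker (B ^^ Suc n) \<subseteq> ker (B ^^ n)")
  case True
  then show thesis
    by (intro that[of 0]) auto
next
  case False
  then show thesis
    using ker_funpow_Suc_decompose[OF B] that by (metis subsetI)
qed

section \<open>Finite dimension of the kernels and separability of the space\<close>

lemma ker_funpow_span:
  assumes B: "generalized_backward_shift B"
  shows "\<exists>S. finite S \<and> ker (B ^^ n) \<subseteq> complex_vector.span S"
proof (induction n)
  case 0
  then show ?case by (intro exI[of _ "{}"]) (auto simp: ker_def)
next
  case (Suc n)
  then obtain S where S: "finite S" "ker (B ^^ n) \<subseteq> complex_vector.span S"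
    by blast
  obtain u where u: "\<And>y. y \<in> ker (B ^^ Suc n) \<Longrightarrow> \<exists>c. \<exists>z\<in>ker (B ^^ n). y = c *\<^sub>C u + z"
    using ker_funpow_Suc_subset[OF B] by blast
  have "ker (B ^^ Suc n) \<subseteq> complex_vector.span (insert u S)"
  proof
    fix y assume "y \<in> ker (B ^^ Suc n)"
    then obtain c z where "z \<in> ker (B ^^ n)" "y = c *\<^sub>C u + z"
      using u by blast
    then show "y \<in> complex_vector.span (insert u S)"
      using S(2) by (auto simp: complex_vector.span_insert intro!: exI[of _ c])
  qed
  with S(1) show ?case by blast
qed

text \<open>Take the combinations \<open>c *\<^sub>C u + z\<close> with \<open>c\<close> in a
  countable dense set of scalars and \<open>z\<close> in the set from the previous level; continuity
  in \<open>(c, z)\<close> carries the density over.\<close>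

lemma ker_funpow_separable:
  assumes B: "generalized_backward_shift B"
  shows "\<exists>D. countable D \<and> ker (B ^^ n) \<subseteq> closure D"
proof (induction n)
  case 0
  then show ?case by (intro exI[of _ "{0}"]) (auto simp: ker_def)
next
  case (Suc n)
  then obtain D where D: "countable D" "ker (B ^^ n) \<subseteq> closure D"
    by blast
  obtain u where u: "\<And>y. y \<in> ker (B ^^ Suc n) \<Longrightarrow> \<exists>c. \<exists>z\<in>ker (B ^^ n). y = c *\<^sub>C u + z"
    using ker_funpow_Suc_subset[OF B] by blast
  obtain Q :: "complex set" where Q: "countable Q" "\<And>X. open X \<Longrightarrow> X \<noteq> {} \<Longrightarrow> \<exists>q\<in>Q. q \<in> X"
    using countable_dense_setE by blast
  have "- closure Q = {}"
    using Q(2)[of "- closure Q"] closure_subset[of Q] by blast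
  then have Q_dense: "closure Q = UNIV" by blast
  let ?f = "\<lambda>(c, z). c *\<^sub>C u + z"
  have "?f ` closure (Q \<times> D) \<subseteq> closure (?f ` (Q \<times> D))"
    unfolding case_prod_beta
    by (rule image_closure_subset) (auto intro!: continuous_intros closure_subset)
  moreover have "ker (B ^^ Suc n) \<subseteq> ?f ` closure (Q \<times> D)"
    using u D(2) Q_dense by (fastforce simp: closure_Times)
  ultimately have "ker (B ^^ Suc n) \<subseteq> closure (?f ` (Q \<times> D))" by blast
  then show ?case
    using D(1) Q(1) by (intro exI[of _ "?f ` (Q \<times> D)"] conjI countable_image countable_SIGMA)
qed

lemma generalized_backward_shift_separable:
  fixes B :: "'a::complex_banach \<Rightarrow> 'a"
  assumes B: "generalized_backward_shift B"
  obtains D :: "'a set" where "countable D" "closure D = UNIV"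
proof -
  obtain D where D: "\<And>n. countable (D n)" "\<And>n. ker (B ^^ n) \<subseteq> closure (D n)"
    using ker_funpow_separable[OF B] by metis
  have "(\<Union>n. ker (B ^^ n)) \<subseteq> closure (\<Union>n. D n)"
    using D(2) closure_mono[of "D _" "\<Union>n. D n"] by blast
  then have "closure (\<Union>n. D n) = UNIV"
    using B closure_minimal[of "\<Union>n. ker (B ^^ n)" "closure (\<Union>n. D n)"]
    unfolding generalized_backward_shift_def by auto
  with D(1) show thesis
    by (intro that[of "\<Union>n. D n"]) auto
qed

section \<open>Strict growth of the kernel chain\<close>

lemma ker_funpow_mono:
  fixes B :: "'a::complex_normed_vector \<Rightarrow> 'a"
  assumes "bounded_clinear B" "m \<le> n"
  shows "ker (B ^^ m) \<subseteq> ker (B ^^ n)"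
proof -
  have "B ^^ n = B ^^ (n - m) \<circ> B ^^ m"
    using assms(2) by (simp flip: funpow_add)
  then show ?thesis
    by (auto simp: ker_def bounded_clinear_simps[OF bounded_clinear_funpow[OF assms(1)]])
qed

lemma ker_funpow_Suc_iff: "x \<in> ker (B ^^ Suc n) \<longleftrightarrow> B x \<in> ker (B ^^ n)"
  by (simp add: ker_def funpow_swap1)

text \<open>A chain that stops once stops forever. The dense union would then lie in the closed set
  \<open>ker (B ^^ n)\<close>, making the whole space finite-dimensional.\<close>

lemma ker_funpow_Suc_not_subset:
  fixes B :: "'a::complex_banach \<Rightarrow> 'a"
  assumes inf: "infinite_dimensional TYPE('a)"
    and B: "generalized_backward_shift B"
  shows "\<not> ker (B ^^ Suc n) \<subseteq> ker (B ^^ n)"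
proof
  have lin: "bounded_clinear B"
    using B by (simp add: generalized_backward_shift_def)
  assume stat: "ker (B ^^ Suc n) \<subseteq> ker (B ^^ n)"
  have stable: "ker (B ^^ (n + k)) \<subseteq> ker (B ^^ n)" for k
  proof (induction k)
    case (Suc k)
    have "x \<in> ker (B ^^ n)" if "x \<in> ker (B ^^ (n + Suc k))" for x
    proof -
      have "B x \<in> ker (B ^^ n)"
        using Suc that unfolding add_Suc_right ker_funpow_Suc_iff by blast
      then show ?thesis
        using stat ker_funpow_Suc_iff[of x n B] by blast
    qed
    then show ?case by blast
  qed simp
  have "ker (B ^^ m) \<subseteq> ker (B ^^ n)" for m
    using stable[of m] ker_funpow_mono[OF lin, of m "n + m"] by auto
  then have "closure (\<Union>m. ker (B ^^ m)) \<subseteq> ker (B ^^ n)"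
    by (intro closure_minimal closed_ker bounded_clinear_funpow lin) blast
  then have "ker (B ^^ n) = UNIV"
    using B by (auto simp: generalized_backward_shift_def)
  then show False
    using ker_funpow_span[OF B, of n] inf by (auto simp: infinite_dimensional_def top_unique)
qed

text \<open>By strict growth, some \<open>B y\<close> lies in \<open>ker (B ^^ Suc n)\<close> but
  not in \<open>ker (B ^^ n)\<close>. Modulo \<open>ker (B ^^ n)\<close>, which is in the range by
  induction, its multiples exhaust the next level.\<close>

lemma ker_funpow_subset_range:
  fixes B :: "'a::complex_banach \<Rightarrow> 'a"
  assumes inf: "infinite_dimensional TYPE('a)"
    and B: "generalized_backward_shift B"
  shows "ker (B ^^ n) \<subseteq> range B"
proof -
  have lin: "bounded_clinear B"
    using B by (simp add: generalized_backward_shift_def)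
  note B_simps = bounded_clinear_simps[OF lin]
  show ?thesis
  proof (induction n)
    case 0
    show ?case
      using B_simps(3) by (force simp: ker_def)
  next
    case (Suc n)
    obtain y where y: "y \<in> ker (B ^^ Suc (Suc n))" "y \<notin> ker (B ^^ Suc n)"
      using ker_funpow_Suc_not_subset[OF inf B] by blast
    have By: "B y \<in> ker (B ^^ Suc n)" "B y \<notin> ker (B ^^ n)"
      using y unfolding ker_funpow_Suc_iff[of y _ B] by blast+
    show ?case
    proof
      fix v assume "v \<in> ker (B ^^ Suc n)"
      then obtain c z where z: "z \<in> ker (B ^^ n)" "v = c *\<^sub>C B y + z"
        using ker_funpow_Suc_decompose[OF B By] by blast
      obtain x where "z = B x"
        using Suc z(1) by blast
      then have "v = B (c *\<^sub>C y + x)"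
        using z(2) by (simp add: B_simps)
      then show "v \<in> range B" by blast
    qed
  qed
qed

section \<open>Extended eigenoperators\<close>

lemma extended_eigenoperator_funpow:
  assumes "extended_eigenoperator l B A"
    and B: "bounded_clinear B"
  shows "(B ^^ n) (A x) = l ^ n *\<^sub>C A ((B ^^ n) x)"
  using assms(1)
  by (induction n)
    (simp_all add: extended_eigenoperator_def bounded_clinear_simps[OF B] scaleC_scaleC
      scaleC_one mult.commute)

text \<open>\<open>A\<close> lowers the level by one: if \<open>v\<close> is in
  \<open>ker (B ^^ Suc n)\<close>, then \<open>(B ^^ n) v\<close> is in \<open>ker B\<close>, hence
  in \<open>ker A\<close>, and \<open>(B ^^ n) (A v)\<close> is a multiple of
  \<open>A ((B ^^ n) v) = 0\<close>.\<close>

lemma extended_eigenoperator_nilpotent: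
  assumes eig: "extended_eigenoperator l B A"
    and B: "bounded_clinear B"
    and sub: "ker B \<subseteq> ker A"
    and "v \<in> ker (B ^^ n)"
  shows "(A ^^ n) v = 0"
  using \<open>v \<in> ker (B ^^ n)\<close>
proof (induction n arbitrary: v)
  case (Suc n)
  have "(B ^^ n) v \<in> ker A"
    using Suc.prems sub by (auto simp: ker_def)
  then have "A v \<in> ker (B ^^ n)"
    by (simp add: ker_def extended_eigenoperator_funpow[OF eig B])
  with Suc.IH show ?case
    by (simp add: funpow_swap1)
qed (simp add: ker_def)

lemma extended_eigenoperator_ker_subset_image:
  assumes eig: "extended_eigenoperator l B A"
    and B: "generalized_backward_shift B"
  shows "ker B \<subseteq> A ` (\<Union>n. ker (B ^^ n))"
proof -
  let ?V = "\<Union>n. ker (B ^^ n)"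
  have A: "bounded_clinear A" and comm: "\<And>x. B (A x) = l *\<^sub>C A (B x)" and nz: "A \<noteq> (\<lambda>x. 0)"
    using eig by (auto simp: extended_eigenoperator_def)
  have lin: "bounded_clinear B" and dense: "closure ?V = UNIV"
    using B by (auto simp: generalized_backward_shift_def)
  \<comment> \<open>A nonzero operator with closed kernel cannot vanish on a dense set.\<close>
  have "\<not> ?V \<subseteq> ker A"
  proof
    assume "?V \<subseteq> ker A"
    then have "ker A = UNIV"
      using closure_minimal[OF _ closed_ker[OF A]] dense by blast
    then show False
      using nz by (auto simp: ker_def)
  qed
  then have ex: "\<exists>n. \<not> ker (B ^^ n) \<subseteq> ker A"
    by blast
  define m where "m = (LEAST n. \<not> ker (B ^^ n) \<subseteq> ker A)"
  have m: "\<not> ker (B ^^ m) \<subseteq> ker A"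
    unfolding m_def using ex by (rule LeastI_ex)
  then obtain k where k: "m = Suc k"
    by (cases m) (auto simp: ker_def bounded_clinear_simps[OF A])
  have below: "ker (B ^^ k) \<subseteq> ker A"
    using not_less_Least[of k "\<lambda>n. \<not> ker (B ^^ n) \<subseteq> ker A"] k by (auto simp: m_def)
  obtain y where y: "y \<in> ker (B ^^ m)" "A y \<noteq> 0"
    using m by (auto simp: ker_def)
  \<comment> \<open>By minimality of \<open>m\<close>: \<open>B y\<close> lies one level below
    \<open>y\<close>, where \<open>A\<close> still vanishes.\<close>
  have "A (B y) = 0"
    using y(1) below ker_funpow_Suc_iff[of y k B] by (auto simp: k ker_def)
  then have Ay: "A y \<in> ker B"
    by (simp add: ker_def comm)
  obtain e where e: "ker B = range (\<lambda>c. c *\<^sub>C e)"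
    using generalized_backward_shift_ker[OF B] by blast
  obtain a where a: "A y = a *\<^sub>C e"
    using Ay e by blast
  with y(2) have "a \<noteq> 0" by auto
  show ?thesis
  proof
    fix x assume "x \<in> ker B"
    then obtain c where "x = c *\<^sub>C e"
      using e by blast
    with \<open>a \<noteq> 0\<close> a have "x = A ((c / a) *\<^sub>C y)"
      by (simp add: bounded_clinear_simps[OF A] scaleC_scaleC)
    moreover have "(c / a) *\<^sub>C y \<in> ker (B ^^ m)"
      using y(1) by (simp add: ker_def bounded_clinear_simps[OF bounded_clinear_funpow[OF lin]])
    ultimately show "x \<in> A ` ?V" by blast
  qed
qed

text \<open>Induction on the level: a preimage of \<open>B v\<close> under \<open>A\<close> is
  lifted through \<open>B\<close> to a preimage of \<open>v\<close> up to an error in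
  \<open>ker B\<close>, and that error is itself in the image of \<open>A\<close> on the
  union.\<close>

lemma extended_eigenoperator_surj:
  fixes B :: "'a::complex_banach \<Rightarrow> 'a"
  assumes inf: "infinite_dimensional TYPE('a)"
    and B: "generalized_backward_shift B"
    and "l \<noteq> 0"
    and eig: "extended_eigenoperator l B A"
  shows "(\<Union>n. ker (B ^^ n)) \<subseteq> A ` (\<Union>n. ker (B ^^ n))"
proof -
  let ?V = "\<Union>n. ker (B ^^ n)"
  have A: "bounded_clinear A" and comm: "\<And>x. B (A x) = l *\<^sub>C A (B x)"
    using eig by (auto simp: extended_eigenoperator_def)
  have lin: "bounded_clinear B"
    using B by (auto simp: generalized_backward_shift_def)
  \<comment> \<open>The kernels are nested, so both vectors lie in the larger one.\<close>
  have V_add: "x + c *\<^sub>C y \<in> ?V" if xy: "x \<in> ?V" "y \<in> ?V" for x y c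
  proof -
    obtain i j where "x \<in> ker (B ^^ i)" "y \<in> ker (B ^^ j)"
      using xy by blast
    then have "x \<in> ker (B ^^ max i j)" "y \<in> ker (B ^^ max i j)"
      using ker_funpow_mono[OF lin, of _ "max i j"] by (meson max.cobounded1 max.cobounded2 subsetD)+
    then have "x + c *\<^sub>C y \<in> ker (B ^^ max i j)"
      by (simp add: ker_def bounded_clinear_simps[OF bounded_clinear_funpow[OF lin]])
    then show ?thesis by blast
  qed
  have "ker (B ^^ n) \<subseteq> A ` ?V" for n
  proof (induction n)
    case 0
    have "ker (B ^^ 0) = {A 0}"
      by (auto simp: ker_def bounded_clinear_simps[OF A])
    moreover have "0 \<in> ker (B ^^ 0)"
      by (simp add: ker_def)
    ultimately show ?case
      by (metis UN_I UNIV_I empty_subsetI imageI insert_subset)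
  next
    case (Suc n)
    show ?case
    proof
      fix v assume "v \<in> ker (B ^^ Suc n)"
      then have "B v \<in> A ` ?V"
        using Suc by (auto simp only: ker_funpow_Suc_iff)
      then obtain w where w: "w \<in> ?V" "B v = A w"
        by (rule imageE)
      then obtain i where i: "w \<in> ker (B ^^ i)" by blast
      then obtain x where x: "w = B x"
        using ker_funpow_subset_range[OF inf B, of i] by blast
      have x_V: "x \<in> ?V"
        using i unfolding x ker_funpow_Suc_iff[symmetric] by blast
      \<comment> \<open>Here \<open>B (A x) = l *\<^sub>C A (B x) = l *\<^sub>C B v\<close>, which
        dictates the factor \<open>inverse l\<close>.\<close>
      have "v - inverse l *\<^sub>C A x \<in> ker B"
        using \<open>l \<noteq> 0\<close> by (simp add: ker_def bounded_clinear_simps[OF lin] comm w(2) x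
            scaleC_scaleC scaleC_one)
      then obtain r where r: "r \<in> ?V" "v - inverse l *\<^sub>C A x = A r"
        using extended_eigenoperator_ker_subset_image[OF eig B] by blast
      have "v = A (r + inverse l *\<^sub>C x)"
        using r(2) by (simp add: bounded_clinear_simps[OF A] algebra_simps)
      then show "v \<in> A ` ?V"
        using V_add[OF r(1) x_V] by blast
    qed
  qed
  then show ?thesis by blast
qed

theorem proposition5p1:
  fixes B A :: "'a::complex_banach \<Rightarrow> 'a" and l :: complex
  assumes "infinite_dimensional TYPE('a)"
    and "generalized_backward_shift B"
    and "l \<noteq> 0"
    and "extended_eigenoperator l B A"
    and "ker B \<subseteq> ker A"
  shows "supercyclic A"
proof -
  let ?V = "\<Union>n. ker (B ^^ n)"
  have B: "bounded_clinear B" and dense: "closure ?V = UNIV"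
    using assms(2) by (auto simp: generalized_backward_shift_def)
  have A: "bounded_clinear A"
    using assms(4) by (simp add: extended_eigenoperator_def)
  obtain D :: "'a set" where D: "countable D" "closure D = UNIV"
    using generalized_backward_shift_separable[OF assms(2)] by blast
  have "\<exists>n. (A ^^ n) v = 0" if "v \<in> ?V" for v
    using that extended_eigenoperator_nilpotent[OF assms(4) B assms(5)] by blast
  with extended_eigenoperator_surj[OF assms(1-4)] show ?thesis
    by (intro supercyclicI_locally_nilpotent[OF A D dense])
qed

end
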